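(* Let $\mathcal{C}$ be a triangulated category with shift functor $[1]$. Let $(\mathcal{Q},\widetilde{\mathcal{R}})$ and $(\widetilde{\mathcal{Q}},\mathcal{R})$ be two hereditary cotorsion pairs in $\mathcal{C}$ such that $\widetilde{\mathcal{R}}\subseteq\mathcal{R}$, $\widetilde{\mathcal{Q}}\subseteq\mathcal{Q}$ and $\widetilde{\mathcal{Q}}\cap\mathcal{R}=\mathcal{Q}\cap\widetilde{\mathcal{R}}$. Then there exists a unique thick class $\mathcal{W}$ of objects of $\mathcal{C}$ for which $(\mathcal{Q},\mathcal{W},\mathcal{R})$ is a Hovey triple. Moreover, this thick class $\mathcal{W}$ can be described in the two following ways: $$\mathcal{W}=\{X\in\mathcal{C}\mid \text{there exists a triangle } X\to R\to Q\to X[1] \text{ with } R\in\widetilde{\mathcal{R}},\ Q\in\widetilde{\mathcal{Q}}\}$$ $$\phantom{\mathcal{W}}=\{X\in\mathcal{C}\mid \text{there exists a triangle } R'\to Q'\to X\to R'[1] \text{ with } R'\in\widetilde{\mathcal{R}},\ Q'\in\widetilde{\mathcal{Q}}\}.$$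
   Context: "Triangle" means distinguished triangle. The notions below are the paper's definitions for extriangulated categories, read in a triangulated category viewed as an extriangulated category with $\mathbb{E}(C,A)=\mathrm{Hom}_{\mathcal{C}}(C,A[1])$ and with $\mathbb{E}$-triangles $A\to B\to C\dashrightarrow$ being the distinguished triangles $A\to B\to C\to A[1]$. Let $\mathcal{Q},\mathcal{R}$ be classes of objects (full additive subcategories) of $\mathcal{C}$, closed under isomorphisms, finite direct sums and direct summands. $(\mathcal{Q},\mathcal{R})$ is a cotorsion pair if (a) $\mathrm{Hom}_{\mathcal{C}}(Q,R[1])=0$ for all $Q\in\mathcal{Q}$, $R\in\mathcal{R}$; and (b) for every $C\in\mathcal{C}$ there are triangles $R_C\to Q_C\to C\to R_C[1]$ and $C\to R^C\to Q^C\to C[1]$ with $Q_C,Q^C\in\mathcal{Q}$ and $R_C,R^C\in\mathcal{R}$. A cotorsion pair $(\mathcal{Q},\mathcal{R})$ is hereditary if for any triangle $A\to B\to C\to A[1]$: $B,C\in\mathcal{Q}$ implies $A\in\mathcal{Q}$, and $A,B\in\mathcal{R}$ implies $C\in\mathcal{R}$. A class $\mathcal{W}$ of objects is thick if it is closed under direct summands and, for any triangle $A\to B\to C\to A[1]$ with two of $A,B,C$ in $\mathcal{W}$, the third is in $\mathcal{W}$. A triple $(\mathcal{Q},\mathcal{W},\mathcal{R})$ of classes of objects is a Hovey triple if $(\mathcal{Q},\mathcal{W}\cap\mathcal{R})$ and $(\mathcal{Q}\cap\mathcal{W},\mathcal{R})$ are cotorsion pairs and $\mathcal{W}$ is thick.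 *)

theory Defs
  imports "HOL-Algebra.Group"
begin

section \<open>Triangulated categories\<close>

text \<open>
  Each hom-set carries its abelian group structure as a \<^typ>\<open>'m monoid\<close>. The library
  writes such groups multiplicatively: the sum of two parallel morphisms is \<open>\<otimes>\<close>,
  the zero morphism is \<open>\<one>\<close> and the negative of a morphism is \<open>inv\<close>.
  \<open>Tri C X Y Z f g h\<close> says that X --f--> Y --g--> Z --h--> X[1] is a distinguished triangle.
\<close>

record ('o, 'm) triang_data =
  Ob :: "'o set"
  Hom :: "'o \<Rightarrow> 'o \<Rightarrow> 'm monoid"
  Id :: "'o \<Rightarrow> 'm"
  Comp :: "'m \<Rightarrow> 'm \<Rightarrow> 'm"  (infixr "\<cdot>\<index>" 70)
  Shift :: "'o \<Rightarrow> 'o"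
  ShiftM :: "'m \<Rightarrow> 'm"
  Tri :: "'o \<Rightarrow> 'o \<Rightarrow> 'o \<Rightarrow> 'm \<Rightarrow> 'm \<Rightarrow> 'm \<Rightarrow> bool"

abbreviation mor :: "('o, 'm, 'x) triang_data_scheme \<Rightarrow> 'o \<Rightarrow> 'o \<Rightarrow> 'm set" where
  "mor C X Y \<equiv> carrier (Hom C X Y)"

abbreviation zero_mor :: "('o, 'm, 'x) triang_data_scheme \<Rightarrow> 'o \<Rightarrow> 'o \<Rightarrow> 'm" where
  "zero_mor C X Y \<equiv> \<one>\<^bsub>Hom C X Y\<^esub>"

abbreviation add_mor :: "('o, 'm, 'x) triang_data_scheme \<Rightarrow> 'o \<Rightarrow> 'o \<Rightarrow> 'm \<Rightarrow> 'm \<Rightarrow> 'm" where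
  "add_mor C X Y f g \<equiv> f \<otimes>\<^bsub>Hom C X Y\<^esub> g"

abbreviation neg_mor :: "('o, 'm, 'x) triang_data_scheme \<Rightarrow> 'o \<Rightarrow> 'o \<Rightarrow> 'm \<Rightarrow> 'm" where
  "neg_mor C X Y f \<equiv> inv\<^bsub>Hom C X Y\<^esub> f"

definition is_iso :: "('o, 'm, 'x) triang_data_scheme \<Rightarrow> 'o \<Rightarrow> 'o \<Rightarrow> 'm \<Rightarrow> bool" where
  "is_iso C X Y f \<longleftrightarrow> f \<in> mor C X Y \<and>
     (\<exists>g\<in>mor C Y X. g \<cdot>\<^bsub>C\<^esub> f = Id C X \<and> f \<cdot>\<^bsub>C\<^esub> g = Id C Y)"

definition isomorphic :: "('o, 'm, 'x) triang_data_scheme \<Rightarrow> 'o \<Rightarrow> 'o \<Rightarrow> bool" where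
  "isomorphic C X Y \<longleftrightarrow> (\<exists>f. is_iso C X Y f)"

definition is_zero_object :: "('o, 'm, 'x) triang_data_scheme \<Rightarrow> 'o \<Rightarrow> bool" where
  "is_zero_object C Z \<longleftrightarrow> Z \<in> Ob C \<and>
     (\<forall>X\<in>Ob C. (\<exists>!f. f \<in> mor C X Z) \<and> (\<exists>!f. f \<in> mor C Z X))"

definition is_direct_sum :: "('o, 'm, 'x) triang_data_scheme \<Rightarrow> 'o \<Rightarrow> 'o \<Rightarrow> 'o \<Rightarrow> bool" where
  "is_direct_sum C A B S \<longleftrightarrow> A \<in> Ob C \<and> B \<in> Ob C \<and> S \<in> Ob C \<and>
     (\<exists>i\<in>mor C A S. \<exists>j\<in>mor C B S. \<exists>p\<in>mor C S A. \<exists>q\<in>mor C S B.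
        p \<cdot>\<^bsub>C\<^esub> i = Id C A \<and> q \<cdot>\<^bsub>C\<^esub> j = Id C B \<and>
        p \<cdot>\<^bsub>C\<^esub> j = zero_mor C B A \<and> q \<cdot>\<^bsub>C\<^esub> i = zero_mor C A B \<and>
        add_mor C S S (i \<cdot>\<^bsub>C\<^esub> p) (j \<cdot>\<^bsub>C\<^esub> q) = Id C S)"

locale additive_category =
  fixes C :: "('o, 'm, 'x) triang_data_scheme" (structure)
  assumes mor_disjoint: "\<lbrakk>X \<in> Ob C; Y \<in> Ob C; X' \<in> Ob C; Y' \<in> Ob C;
        f \<in> mor C X Y; f \<in> mor C X' Y'\<rbrakk> \<Longrightarrow> X = X' \<and> Y = Y'"
    and Id_mor: "X \<in> Ob C \<Longrightarrow> Id C X \<in> mor C X X"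
    and Comp_mor: "\<lbrakk>X \<in> Ob C; Y \<in> Ob C; Z \<in> Ob C; f \<in> mor C X Y; g \<in> mor C Y Z\<rbrakk>
        \<Longrightarrow> g \<cdot> f \<in> mor C X Z"
    and Comp_Id: "\<lbrakk>X \<in> Ob C; Y \<in> Ob C; f \<in> mor C X Y\<rbrakk> \<Longrightarrow> f \<cdot> Id C X = f"
    and Id_Comp: "\<lbrakk>X \<in> Ob C; Y \<in> Ob C; f \<in> mor C X Y\<rbrakk> \<Longrightarrow> Id C Y \<cdot> f = f"
    and Comp_assoc: "\<lbrakk>W \<in> Ob C; X \<in> Ob C; Y \<in> Ob C; Z \<in> Ob C;
        f \<in> mor C W X; g \<in> mor C X Y; h \<in> mor C Y Z\<rbrakk> \<Longrightarrow> (h \<cdot> g) \<cdot> f = h \<cdot> (g \<cdot> f)"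
    and Hom_group: "\<lbrakk>X \<in> Ob C; Y \<in> Ob C\<rbrakk> \<Longrightarrow> comm_group (Hom C X Y)"
    and Comp_add_right: "\<lbrakk>X \<in> Ob C; Y \<in> Ob C; Z \<in> Ob C;
        f \<in> mor C X Y; f' \<in> mor C X Y; g \<in> mor C Y Z\<rbrakk>
        \<Longrightarrow> g \<cdot> add_mor C X Y f f' = add_mor C X Z (g \<cdot> f) (g \<cdot> f')"
    and Comp_add_left: "\<lbrakk>X \<in> Ob C; Y \<in> Ob C; Z \<in> Ob C;
        f \<in> mor C X Y; g \<in> mor C Y Z; g' \<in> mor C Y Z\<rbrakk>
        \<Longrightarrow> add_mor C Y Z g g' \<cdot> f = add_mor C X Z (g \<cdot> f) (g' \<cdot> f)"
    and zero_object_exists: "\<exists>Z. is_zero_object C Z"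
    and direct_sum_exists: "\<lbrakk>A \<in> Ob C; B \<in> Ob C\<rbrakk> \<Longrightarrow> \<exists>S. is_direct_sum C A B S"

text \<open>The shift is an additive autoequivalence; it need not be strictly invertible.\<close>

locale shift_category = additive_category +
  assumes Shift_Ob: "X \<in> Ob C \<Longrightarrow> Shift C X \<in> Ob C"
    and ShiftM_hom: "\<lbrakk>X \<in> Ob C; Y \<in> Ob C\<rbrakk>
        \<Longrightarrow> ShiftM C \<in> hom (Hom C X Y) (Hom C (Shift C X) (Shift C Y))"
    and ShiftM_Id: "X \<in> Ob C \<Longrightarrow> ShiftM C (Id C X) = Id C (Shift C X)"
    and ShiftM_Comp: "\<lbrakk>X \<in> Ob C; Y \<in> Ob C; Z \<in> Ob C; f \<in> mor C X Y; g \<in> mor C Y Z\<rbrakk>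
        \<Longrightarrow> ShiftM C (g \<cdot> f) = ShiftM C g \<cdot> ShiftM C f"
    and ShiftM_fully_faithful: "\<lbrakk>X \<in> Ob C; Y \<in> Ob C\<rbrakk>
        \<Longrightarrow> bij_betw (ShiftM C) (mor C X Y) (mor C (Shift C X) (Shift C Y))"
    and Shift_ess_surj: "Y \<in> Ob C \<Longrightarrow> \<exists>X\<in>Ob C. isomorphic C (Shift C X) Y"

locale triangulated_category = shift_category +
  assumes Tri_mor: "Tri C X Y Z f g h \<Longrightarrow>
        X \<in> Ob C \<and> Y \<in> Ob C \<and> Z \<in> Ob C \<and>
        f \<in> mor C X Y \<and> g \<in> mor C Y Z \<and> h \<in> mor C Z (Shift C X)"
    and Tri_iso: "\<lbrakk>Tri C X Y Z f g h;
        X' \<in> Ob C; Y' \<in> Ob C; Z' \<in> Ob C;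
        f' \<in> mor C X' Y'; g' \<in> mor C Y' Z'; h' \<in> mor C Z' (Shift C X');
        is_iso C X X' a; is_iso C Y Y' b; is_iso C Z Z' c;
        b \<cdot> f = f' \<cdot> a; c \<cdot> g = g' \<cdot> b; ShiftM C a \<cdot> h = h' \<cdot> c\<rbrakk>
        \<Longrightarrow> Tri C X' Y' Z' f' g' h'"
    and Tri_Id: "\<lbrakk>X \<in> Ob C; is_zero_object C Z\<rbrakk>
        \<Longrightarrow> Tri C X X Z (Id C X) (zero_mor C X Z) (zero_mor C Z (Shift C X))"
    and Tri_cone: "\<lbrakk>X \<in> Ob C; Y \<in> Ob C; f \<in> mor C X Y\<rbrakk> \<Longrightarrow> \<exists>Z g h. Tri C X Y Z f g h"
    and Tri_rotate: "\<lbrakk>X \<in> Ob C; Y \<in> Ob C; Z \<in> Ob C;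
        f \<in> mor C X Y; g \<in> mor C Y Z; h \<in> mor C Z (Shift C X)\<rbrakk>
        \<Longrightarrow> Tri C X Y Z f g h \<longleftrightarrow>
            Tri C Y Z (Shift C X) g h (neg_mor C (Shift C X) (Shift C Y) (ShiftM C f))"
    and Tri_fill: "\<lbrakk>Tri C X Y Z f g h; Tri C X' Y' Z' f' g' h';
        a \<in> mor C X X'; b \<in> mor C Y Y'; b \<cdot> f = f' \<cdot> a\<rbrakk>
        \<Longrightarrow> \<exists>c\<in>mor C Z Z'. c \<cdot> g = g' \<cdot> b \<and> ShiftM C a \<cdot> h = h' \<cdot> c"
    and Tri_octahedral: "\<lbrakk>Tri C X Y Z' f a b; Tri C Y Z X' g c d; Tri C X Z Y' (g \<cdot> f) e k\<rbrakk>
        \<Longrightarrow> \<exists>u\<in>mor C Z' Y'. \<exists>v\<in>mor C Y' X'.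
              Tri C Z' Y' X' u v (ShiftM C a \<cdot> d) \<and>
              u \<cdot> a = e \<cdot> g \<and> k \<cdot> u = b \<and> v \<cdot> e = c \<and> d \<cdot> v = ShiftM C f \<cdot> k"


section \<open>Cotorsion pairs and Hovey triples\<close>

definition summand_closed :: "('o, 'm, 'x) triang_data_scheme \<Rightarrow> 'o set \<Rightarrow> bool" where
  "summand_closed C W \<longleftrightarrow> (\<forall>A B S. is_direct_sum C A B S \<longrightarrow> S \<in> W \<longrightarrow> A \<in> W \<and> B \<in> W)"

text \<open>Finite direct sums include the empty one, i.e. the zero objects.\<close>

definition additive_class :: "('o, 'm, 'x) triang_data_scheme \<Rightarrow> 'o set \<Rightarrow> bool" where
  "additive_class C Q \<longleftrightarrow> Q \<subseteq> Ob C \<and>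
     (\<forall>X\<in>Q. \<forall>Y\<in>Ob C. isomorphic C X Y \<longrightarrow> Y \<in> Q) \<and>
     (\<forall>Z. is_zero_object C Z \<longrightarrow> Z \<in> Q) \<and>
     (\<forall>A\<in>Q. \<forall>B\<in>Q. \<forall>S. is_direct_sum C A B S \<longrightarrow> S \<in> Q) \<and>
     summand_closed C Q"

definition cotorsion_pair :: "('o, 'm, 'x) triang_data_scheme \<Rightarrow> 'o set \<Rightarrow> 'o set \<Rightarrow> bool" where
  "cotorsion_pair C Q R \<longleftrightarrow> additive_class C Q \<and> additive_class C R \<and>
     (\<forall>X\<in>Q. \<forall>Y\<in>R. mor C X (Shift C Y) = {zero_mor C X (Shift C Y)}) \<and>
     (\<forall>X\<in>Ob C. (\<exists>R0\<in>R. \<exists>Q0\<in>Q. \<exists>f g h. Tri C R0 Q0 X f g h) \<and>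
                (\<exists>R1\<in>R. \<exists>Q1\<in>Q. \<exists>f g h. Tri C X R1 Q1 f g h))"

definition hereditary_cotorsion_pair ::
    "('o, 'm, 'x) triang_data_scheme \<Rightarrow> 'o set \<Rightarrow> 'o set \<Rightarrow> bool" where
  "hereditary_cotorsion_pair C Q R \<longleftrightarrow> cotorsion_pair C Q R \<and>
     (\<forall>X Y Z f g h. Tri C X Y Z f g h \<longrightarrow>
        (Y \<in> Q \<and> Z \<in> Q \<longrightarrow> X \<in> Q) \<and> (X \<in> R \<and> Y \<in> R \<longrightarrow> Z \<in> R))"

definition thick :: "('o, 'm, 'x) triang_data_scheme \<Rightarrow> 'o set \<Rightarrow> bool" where
  "thick C W \<longleftrightarrow> W \<subseteq> Ob C \<and> summand_closed C W \<and>
     (\<forall>X Y Z f g h. Tri C X Y Z f g h \<longrightarrow>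
        (X \<in> W \<and> Y \<in> W \<longrightarrow> Z \<in> W) \<and>
        (X \<in> W \<and> Z \<in> W \<longrightarrow> Y \<in> W) \<and>
        (Y \<in> W \<and> Z \<in> W \<longrightarrow> X \<in> W))"

definition hovey_triple ::
    "('o, 'm, 'x) triang_data_scheme \<Rightarrow> 'o set \<Rightarrow> 'o set \<Rightarrow> 'o set \<Rightarrow> bool" where
  "hovey_triple C Q W R \<longleftrightarrow>
     cotorsion_pair C Q (W \<inter> R) \<and> cotorsion_pair C (Q \<inter> W) R \<and> thick C W"

end

theory Submission
  imports Defs
begin

text \<open>
  Call \<open>X\<close> trivial if every composite \<open>A \<rightarrow> X \<rightarrow> B[1]\<close> with \<open>A\<close> in \<open>Q\<close> and \<open>B\<close> in \<open>R\<close> vanishes.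
  If \<open>Q\<close> and \<open>R\<close> are thought of as the cofibrant and the fibrant objects of a model structure,
  these are the objects that become zero in its homotopy category. The proof
  compares the trivial objects with the two classes of the theorem, the fibres and the cofibres
  of morphisms from an object of \<open>Rt\<close> to an object of \<open>Qt\<close>: \<open>X\<close> is a fibre if there is
  a triangle \<open>X \<rightarrow> R' \<rightarrow> Q'\<close>, and a cofibre if there is a triangle \<open>R' \<rightarrow> Q' \<rightarrow> X\<close>.

  All three classes agree. Morphisms from \<open>Q\<close> lift along \<open>Q' \<rightarrow> X\<close>, and morphisms to \<open>R[1]\<close>
  extend along \<open>X \<rightarrow> R'\<close>; a composite that passes through an object of \<open>Qt\<close> or of \<open>Rt\<close> is zero, in
  the second case because it can be rerouted through \<open>Q \<inter> Rt = Qt \<inter> R\<close>. Hence fibres and cofibres are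
  trivial. Conversely, if \<open>X\<close> is trivial and \<open>R' \<rightarrow> Q0 \<rightarrow> X\<close> is a triangle with \<open>R'\<close> in \<open>Rt\<close> and \<open>Q0\<close>
  in \<open>Q\<close>, then the identity of \<open>Q0\<close> is a sum of an endomorphism through \<open>Qt\<close> and one through \<open>R'\<close>,
  which puts \<open>Q0\<close> into \<open>Qt\<close> (\<open>trivial_subset_cofibres\<close>). One octahedron turns cofibres into fibres.

  Each description makes one part of thickness easy. Vanishing of composites passes to direct
  summands. Rotation turns a triangle showing that \<open>X\<close> is a fibre into one showing that \<open>X[1]\<close> is a
  cofibre, so triviality is invariant under the shift, and then two-out-of-three is reduced to
  closure under cones, for which one more octahedron suffices (\<open>trivial_cone_closed\<close>). Finally
  \<open>trivial \<inter> R = Rt\<close> and \<open>Q \<inter> trivial = Qt\<close>, because the triangles in question split by orthogonality.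

  Uniqueness rests on the fact that each half of a cotorsion pair determines the other. If
  \<open>(Q, W, R)\<close> is a Hovey triple, then \<open>W \<inter> R = Rt\<close> and \<open>Q \<inter> W = Qt\<close>, and two-out-of-three, applied to a
  triangle \<open>X \<rightarrow> R1 \<rightarrow> Q1\<close> with \<open>R1\<close> in \<open>R\<close> and \<open>Q1\<close> in \<open>Qt\<close>, shows that the members of \<open>W\<close> are the fibres.
\<close>

section \<open>Morphisms in additive categories\<close>

context additive_category
begin

lemma zero_in_mor: "X \<in> Ob C \<Longrightarrow> Y \<in> Ob C \<Longrightarrow> zero_mor C X Y \<in> mor C X Y"
  using Hom_group by (meson comm_groupE(2))

lemma neg_in_mor:
  "X \<in> Ob C \<Longrightarrow> Y \<in> Ob C \<Longrightarrow> f \<in> mor C X Y \<Longrightarrow> neg_mor C X Y f \<in> mor C X Y"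
  using Hom_group by (meson comm_group_def group.inv_closed)

lemma neg_eq_iff:
  "X \<in> Ob C \<Longrightarrow> Y \<in> Ob C \<Longrightarrow> f \<in> mor C X Y \<Longrightarrow> f' \<in> mor C X Y
    \<Longrightarrow> neg_mor C X Y f = neg_mor C X Y f' \<longleftrightarrow> f = f'"
  using Hom_group by (metis comm_group_def group.inv_inv)

lemma postcomp_group_hom:
  assumes "X \<in> Ob C" "Y \<in> Ob C" "Z \<in> Ob C" "g \<in> mor C Y Z"
  shows "group_hom (Hom C X Y) (Hom C X Z) (\<lambda>f. g \<cdot> f)"
  using assms Comp_mor Comp_add_right Hom_group
  by (auto simp: group_hom_def group_hom_axioms_def comm_group_def hom_def)

lemma precomp_group_hom:
  assumes "X \<in> Ob C" "Y \<in> Ob C" "Z \<in> Ob C" "f \<in> mor C X Y"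
  shows "group_hom (Hom C Y Z) (Hom C X Z) (\<lambda>g. g \<cdot> f)"
  using assms Comp_mor Comp_add_left Hom_group
  by (auto simp: group_hom_def group_hom_axioms_def comm_group_def hom_def)

lemma Comp_zero:
  "X \<in> Ob C \<Longrightarrow> Y \<in> Ob C \<Longrightarrow> Z \<in> Ob C \<Longrightarrow> g \<in> mor C Y Z \<Longrightarrow> g \<cdot> zero_mor C X Y = zero_mor C X Z"
  using group_hom.hom_one[OF postcomp_group_hom] by blast

lemma zero_Comp:
  "X \<in> Ob C \<Longrightarrow> Y \<in> Ob C \<Longrightarrow> Z \<in> Ob C \<Longrightarrow> f \<in> mor C X Y \<Longrightarrow> zero_mor C Y Z \<cdot> f = zero_mor C X Z"
  using group_hom.hom_one[OF precomp_group_hom] by blast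

lemma Comp_neg:
  "X \<in> Ob C \<Longrightarrow> Y \<in> Ob C \<Longrightarrow> Z \<in> Ob C \<Longrightarrow> f \<in> mor C X Y \<Longrightarrow> g \<in> mor C Y Z
    \<Longrightarrow> g \<cdot> neg_mor C X Y f = neg_mor C X Z (g \<cdot> f)"
  using group_hom.hom_inv[OF postcomp_group_hom] by blast

lemma neg_Comp:
  "X \<in> Ob C \<Longrightarrow> Y \<in> Ob C \<Longrightarrow> Z \<in> Ob C \<Longrightarrow> f \<in> mor C X Y \<Longrightarrow> g \<in> mor C Y Z
    \<Longrightarrow> neg_mor C Y Z g \<cdot> f = neg_mor C X Z (g \<cdot> f)"
  using group_hom.hom_inv[OF precomp_group_hom] by blast

lemma add_zero:
  "X \<in> Ob C \<Longrightarrow> Y \<in> Ob C \<Longrightarrow> f \<in> mor C X Y \<Longrightarrow> add_mor C X Y f (zero_mor C X Y) = f"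
  using Hom_group by (metis comm_group_def group.is_monoid monoid.r_one)

lemma zero_add:
  "X \<in> Ob C \<Longrightarrow> Y \<in> Ob C \<Longrightarrow> f \<in> mor C X Y \<Longrightarrow> add_mor C X Y (zero_mor C X Y) f = f"
  using Hom_group by (metis comm_group_def group.is_monoid monoid.l_one)

end


section \<open>Exactness and splitting of triangles\<close>

context shift_category
begin

lemma ShiftM_mor:
  "X \<in> Ob C \<Longrightarrow> Y \<in> Ob C \<Longrightarrow> f \<in> mor C X Y \<Longrightarrow> ShiftM C f \<in> mor C (Shift C X) (Shift C Y)"
  using ShiftM_hom by (auto simp: hom_def)

lemma ShiftM_eq_iff:
  "X \<in> Ob C \<Longrightarrow> Y \<in> Ob C \<Longrightarrow> f \<in> mor C X Y \<Longrightarrow> f' \<in> mor C X Y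
    \<Longrightarrow> ShiftM C f = ShiftM C f' \<longleftrightarrow> f = f'"
  using ShiftM_fully_faithful by (meson bij_betw_def inj_on_eq_iff)

lemma ShiftM_full:
  assumes "X \<in> Ob C" "Y \<in> Ob C" "f \<in> mor C (Shift C X) (Shift C Y)"
  obtains f' where "f' \<in> mor C X Y" "ShiftM C f' = f"
  using ShiftM_fully_faithful[OF assms(1,2)] assms(3) by (metis bij_betw_def imageE)

end

context triangulated_category
begin

lemma Tri_rotate_left:
  "Tri C X Y Z f g h
    \<Longrightarrow> Tri C Y Z (Shift C X) g h (neg_mor C (Shift C X) (Shift C Y) (ShiftM C f))"
  using Tri_mor[of X Y Z f g h] Tri_rotate[of X Y Z f g h] by simp

text \<open>
  The missing \<open>f\<close> is a preimage of the negative of \<open>k\<close> under the shift, which is full.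
\<close>
lemma Tri_rotate_right:
  assumes "Tri C Y Z (Shift C X) g h k" "X \<in> Ob C"
  obtains f where "Tri C X Y Z f g h"
proof -
  note m = Tri_mor[OF assms(1)]
  let ?S = "Hom C (Shift C X) (Shift C Y)"
  have "group ?S" using Hom_group m Shift_Ob by (simp add: comm_group_def)
  obtain f where f: "f \<in> mor C X Y" "ShiftM C f = neg_mor C (Shift C X) (Shift C Y) k"
    using ShiftM_full[OF assms(2)] neg_in_mor m by (metis Shift_Ob)
  have "neg_mor C (Shift C X) (Shift C Y) (ShiftM C f) = k"
    using f(2) m \<open>group ?S\<close> by (simp add: group.inv_inv)
  then have "Tri C X Y Z f g h"
    using assms Tri_rotate[of X Y Z f g h] m f(1) by simp
  then show thesis by (rule that)
qed

lemma Tri_to_zero: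
  assumes "X \<in> Ob C" "is_zero_object C Z"
  shows "Tri C X Z (Shift C X) (zero_mor C X Z) (zero_mor C Z (Shift C X))
           (neg_mor C (Shift C X) (Shift C X) (Id C (Shift C X)))"
  using Tri_rotate_left[OF Tri_Id[OF assms]] assms(1) ShiftM_Id by simp

lemma Tri_comp_zero:
  assumes "Tri C X Y Z f g h"
  shows "g \<cdot> f = zero_mor C X Z"
proof -
  note m = Tri_mor[OF assms]
  obtain O' where O': "is_zero_object C O'" using zero_object_exists by blast
  have O: "O' \<in> Ob C" using O' by (simp add: is_zero_object_def)
  obtain c where c: "c \<in> mor C O' Z" "c \<cdot> zero_mor C X O' = g \<cdot> f"
    using Tri_fill[OF Tri_Id[OF _ O'] assms, of X "Id C X" f] m Id_mor by blast
  then show ?thesis using Comp_zero m O by metis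
qed

text \<open>
  A commutative square from \<open>S \<rightarrow> 0\<close> to \<open>Y \<rightarrow> Z\<close> extends to a morphism from the triangle
  \<open>S \<rightarrow> 0 \<rightarrow> S[1]\<close> to the rotated triangle \<open>Y \<rightarrow> Z \<rightarrow> X[1]\<close>, whose third component is the shift of the
  factorization sought.
\<close>
lemma Tri_exact:
  assumes T: "Tri C X Y Z f g h" and S: "S \<in> Ob C" "s \<in> mor C S Y"
    and z: "g \<cdot> s = zero_mor C S Z"
  obtains w where "w \<in> mor C S X" "s = f \<cdot> w"
proof -
  note m = Tri_mor[OF T]
  note T' = Tri_rotate_left[OF T]
  obtain O' where O': "is_zero_object C O'" using zero_object_exists by blast
  have O: "O' \<in> Ob C" using O' by (simp add: is_zero_object_def)
  have sq: "zero_mor C O' Z \<cdot> zero_mor C S O' = g \<cdot> s"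
    using z Comp_zero O S m zero_in_mor by metis
  obtain c where c: "c \<in> mor C (Shift C S) (Shift C X)"
    "ShiftM C s \<cdot> neg_mor C (Shift C S) (Shift C S) (Id C (Shift C S))
      = neg_mor C (Shift C X) (Shift C Y) (ShiftM C f) \<cdot> c"
    using Tri_fill[OF Tri_to_zero[OF S(1) O'] T' S(2) zero_in_mor sq] O m by blast
  obtain w where w: "w \<in> mor C S X" "ShiftM C w = c"
    using ShiftM_full[OF _ _ c(1)] S m by blast
  note sh = Shift_Ob[OF S(1)] Shift_Ob[of X] Shift_Ob[of Y]
  have sM: "ShiftM C s \<in> mor C (Shift C S) (Shift C Y)"
    using S m by (blast intro: ShiftM_mor)
  have fM: "ShiftM C f \<in> mor C (Shift C X) (Shift C Y)"
    using m by (blast intro: ShiftM_mor)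
  have "neg_mor C (Shift C S) (Shift C Y) (ShiftM C s)
      = neg_mor C (Shift C S) (Shift C Y) (ShiftM C f \<cdot> c)"
    using c sh sM fM m by (simp add: Comp_neg neg_Comp Id_mor Comp_Id)
  then have "ShiftM C s = ShiftM C f \<cdot> c"
    using neg_eq_iff sM fM sh c m Comp_mor by metis
  also have "\<dots> = ShiftM C (f \<cdot> w)"
    using ShiftM_Comp w m S by metis
  finally have "s = f \<cdot> w"
    using ShiftM_eq_iff S m w Comp_mor by metis
  with w show thesis using that by blast
qed

lemma Tri_lift:
  assumes T: "Tri C X Y Z f g h" and S: "S \<in> Ob C" "s \<in> mor C S Z"
    and z: "h \<cdot> s = zero_mor C S (Shift C X)"
  obtains w where "w \<in> mor C S Y" "s = g \<cdot> w"
  using Tri_exact[OF Tri_rotate_left[OF T] S z] by blast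

text \<open>
  Dual to lifting. The obstruction to extending \<open>t\<close> along \<open>f\<close> is stated after a shift, as a morphism
  \<open>Z \<rightarrow> V[1]\<close>, because \<open>Z\<close> has no chosen desuspension. Accordingly, the square to be completed goes
  from \<open>Z \<rightarrow> X[1]\<close> to \<open>0 \<rightarrow> V[1]\<close>, and its third component \<open>Y[1] \<rightarrow> V[1]\<close> is the shift of the extension.
\<close>
lemma Tri_extend:
  assumes T: "Tri C X Y Z f g h" and V: "V \<in> Ob C" "t \<in> mor C X V"
    and z: "ShiftM C t \<cdot> h = zero_mor C Z (Shift C V)"
  obtains u where "u \<in> mor C Y V" "t = u \<cdot> f"
proof -
  note m = Tri_mor[OF T]
  note T' = Tri_rotate_left[OF Tri_rotate_left[OF T]]
  obtain O' where O': "is_zero_object C O'" using zero_object_exists by blast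
  have O: "O' \<in> Ob C" using O' by (simp add: is_zero_object_def)
  have tM: "ShiftM C t \<in> mor C (Shift C X) (Shift C V)"
    using V m by (blast intro: ShiftM_mor)
  have sh: "Shift C V \<in> Ob C" "Shift C X \<in> Ob C" "Shift C Y \<in> Ob C"
    using V m Shift_Ob by blast+
  have sq: "ShiftM C t \<cdot> h = zero_mor C O' (Shift C V) \<cdot> zero_mor C Z O'"
    using z Comp_zero O m sh zero_in_mor by metis
  obtain c where c: "c \<in> mor C (Shift C Y) (Shift C V)"
    "c \<cdot> neg_mor C (Shift C X) (Shift C Y) (ShiftM C f)
      = neg_mor C (Shift C V) (Shift C V) (Id C (Shift C V)) \<cdot> ShiftM C t"
    using Tri_fill[OF T' Tri_rotate_left[OF Tri_to_zero[OF V(1) O']] zero_in_mor tM sq] O m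
    by blast
  obtain u where u: "u \<in> mor C Y V" "ShiftM C u = c"
    using ShiftM_full[OF _ _ c(1)] V m by blast
  have fM: "ShiftM C f \<in> mor C (Shift C X) (Shift C Y)"
    using m by (blast intro: ShiftM_mor)
  have "neg_mor C (Shift C X) (Shift C V) (c \<cdot> ShiftM C f)
      = neg_mor C (Shift C X) (Shift C V) (ShiftM C t)"
    using c sh tM fM m by (simp add: Comp_neg neg_Comp Id_mor Id_Comp)
  then have "ShiftM C t = c \<cdot> ShiftM C f"
    using neg_eq_iff tM fM sh c m Comp_mor by metis
  also have "\<dots> = ShiftM C (u \<cdot> f)"
    using ShiftM_Comp u m V by metis
  finally have "t = u \<cdot> f"
    using ShiftM_eq_iff V m u Comp_mor by metis
  with u show thesis using that by blast
qed

lemma Tri_extend_middle: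
  assumes T: "Tri C X Y Z f g h" and V: "V \<in> Ob C" "t \<in> mor C Y V"
    and z: "t \<cdot> f = zero_mor C X V"
  obtains u where "u \<in> mor C Z V" "t = u \<cdot> g"
proof -
  note m = Tri_mor[OF T]
  have sh: "Shift C V \<in> Ob C" "Shift C X \<in> Ob C" "Shift C Y \<in> Ob C"
    using V m Shift_Ob by blast+
  have M: "ShiftM C f \<in> mor C (Shift C X) (Shift C Y)" "ShiftM C t \<in> mor C (Shift C Y) (Shift C V)"
    using m V by (blast intro: ShiftM_mor)+
  interpret A: group "Hom C X V" using Hom_group m V by (simp add: comm_group_def)
  interpret B: group "Hom C (Shift C X) (Shift C V)" using Hom_group sh by (simp add: comm_group_def)
  have "ShiftM C (zero_mor C X V) = zero_mor C (Shift C X) (Shift C V)"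
    using ShiftM_hom[of X V] V m hom_one A.is_group B.is_group by blast
  moreover have "ShiftM C (t \<cdot> f) = ShiftM C t \<cdot> ShiftM C f"
    using ShiftM_Comp V m by metis
  ultimately have "ShiftM C t \<cdot> neg_mor C (Shift C X) (Shift C Y) (ShiftM C f)
      = zero_mor C (Shift C X) (Shift C V)"
    using z M sh Comp_neg[of "Shift C X" "Shift C Y" "Shift C V"] B.inv_one by metis
  then show thesis using Tri_extend[OF Tri_rotate_left[OF T] V] that by blast
qed

text \<open>
  Exactness applied to the difference of two morphisms, stated as a sum so that later arguments
  decompose a morphism without computing with negatives.
\<close>
lemma Tri_difference_factors:
  assumes T: "Tri C X Y Z f g h" and S: "S \<in> Ob C" "s \<in> mor C S Y" "s' \<in> mor C S Y"
    and eq: "g \<cdot> s = g \<cdot> s'"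
  obtains w where "w \<in> mor C S X" "s = add_mor C S Y s' (f \<cdot> w)"
proof -
  note m = Tri_mor[OF T]
  interpret A: comm_group "Hom C S Y" using Hom_group m S by simp
  interpret B: comm_group "Hom C S Z" using Hom_group m S by simp
  let ?d = "add_mor C S Y (neg_mor C S Y s') s"
  have gs: "g \<cdot> s' \<in> mor C S Z" using Comp_mor m S by blast
  have "g \<cdot> ?d = add_mor C S Z (g \<cdot> neg_mor C S Y s') (g \<cdot> s)"
    using Comp_add_right m S A.inv_closed by blast
  then have "g \<cdot> ?d = zero_mor C S Z"
    using eq gs m S Comp_neg[of S Y Z s' g] by simp
  then obtain w where w: "w \<in> mor C S X" "?d = f \<cdot> w"
    using Tri_exact[OF T S(1), of ?d] S by auto
  have "s = add_mor C S Y s' ?d"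
    using S by (simp flip: A.m_assoc)
  with w show thesis using that by metis
qed

text \<open>
  If the connecting morphism vanishes, \<open>g\<close> has a section \<open>j\<close> and \<open>f\<close> has a retraction \<open>r\<close>. The projection
  onto \<open>X\<close> cannot simply be \<open>r\<close>, which need not kill \<open>j\<close>: it is the morphism \<open>p\<close> through which the
  difference of the identity and \<open>j \<cdot> g\<close> factors.
\<close>
lemma Tri_split:
  assumes T: "Tri C X Y Z f g h" and z: "h = zero_mor C Z (Shift C X)"
  shows "is_direct_sum C X Z Y"
proof -
  note m = Tri_mor[OF T]
  have sh: "Shift C X \<in> Ob C" using m Shift_Ob by blast
  interpret A: comm_group "Hom C Z Y" using Hom_group m by simp
  obtain j where j: "j \<in> mor C Z Y" "Id C Z = g \<cdot> j"
    using Tri_lift[OF T, of Z "Id C Z"] m z Id_mor Comp_Id sh by metis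
  obtain r where r: "r \<in> mor C Y X" "Id C X = r \<cdot> f"
    using Tri_extend[OF T, of X "Id C X"] m z Id_mor Id_Comp ShiftM_Id sh by metis
  have jg: "j \<cdot> g \<in> mor C Y Y" using Comp_mor j m by blast
  have gjg: "g \<cdot> Id C Y = g \<cdot> (j \<cdot> g)"
    using Comp_assoc[of Y Z Y Z g j g] j m Comp_Id Id_Comp by metis
  obtain p where p: "p \<in> mor C Y X" "Id C Y = add_mor C Y Y (j \<cdot> g) (f \<cdot> p)"
    using Tri_difference_factors[OF T _ Id_mor jg gjg] m by blast
  have fp: "f \<cdot> p \<in> mor C Y Y" using Comp_mor p m by blast
  \<comment> \<open>Both identities for \<open>p\<close> come from composing the decomposition of the identity of \<open>Y\<close>
    with \<open>f\<close> and \<open>j\<close>, and cancelling the monomorphism \<open>f\<close> by means of its retraction \<open>r\<close>.\<close>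
  have f_cancel: "a = b" if "W \<in> Ob C" "a \<in> mor C W X" "b \<in> mor C W X" "f \<cdot> a = f \<cdot> b" for W a b
    using that Comp_assoc[of W X Y X a f r] Comp_assoc[of W X Y X b f r] r m Id_Comp by metis
  have pf: "p \<cdot> f \<in> mor C X X" and pj: "p \<cdot> j \<in> mor C Z X" using Comp_mor p m j by blast+
  have "f = add_mor C X Y ((j \<cdot> g) \<cdot> f) ((f \<cdot> p) \<cdot> f)"
    using Comp_add_left[of X Y Y f "j \<cdot> g" "f \<cdot> p"] jg fp m p Id_Comp by metis
  also have "(j \<cdot> g) \<cdot> f = zero_mor C X Y"
    using Comp_assoc[of X Y Z Y f g j] Tri_comp_zero[OF T] Comp_zero[of X Z Y j] j m by metis
  also have "(f \<cdot> p) \<cdot> f = f \<cdot> (p \<cdot> f)"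
    using Comp_assoc[of X Y X Y f p f] p m by metis
  also have "add_mor C X Y (zero_mor C X Y) (f \<cdot> (p \<cdot> f)) = f \<cdot> (p \<cdot> f)"
    using zero_add[of X Y] Comp_mor[of X X Y] pf m by blast
  finally have 1: "p \<cdot> f = Id C X"
    using f_cancel[OF _ pf Id_mor] m Comp_Id by metis
  have "j = add_mor C Z Y ((j \<cdot> g) \<cdot> j) ((f \<cdot> p) \<cdot> j)"
    using Comp_add_left[of Z Y Y j "j \<cdot> g" "f \<cdot> p"] jg fp m p j Id_Comp by metis
  also have "(j \<cdot> g) \<cdot> j = j"
    using Comp_assoc[of Z Y Z Y j g j] j m Comp_Id by metis
  also have "(f \<cdot> p) \<cdot> j = f \<cdot> (p \<cdot> j)"
    using Comp_assoc[of Z Y X Y j p f] p m j by metis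
  finally have "f \<cdot> (p \<cdot> j) = zero_mor C Z Y"
    using A.l_cancel_one'[of j "f \<cdot> (p \<cdot> j)"] j Comp_mor[of Z X Y "p \<cdot> j" f] pj m by blast
  then have 2: "p \<cdot> j = zero_mor C Z X"
    using f_cancel[OF _ pj zero_in_mor] m Comp_zero by metis
  have 3: "add_mor C Y Y (f \<cdot> p) (j \<cdot> g) = Id C Y"
  proof -
    interpret B: comm_group "Hom C Y Y" using Hom_group m by simp
    show ?thesis using p fp jg B.m_comm by metis
  qed
  show ?thesis
    unfolding is_direct_sum_def
    using m j p 1 2 3 Tri_comp_zero[OF T] by metis
qed

end


section \<open>Cotorsion pairs\<close>

context triangulated_category
begin

lemma cotorsion_pair_orthogonal:
  "cotorsion_pair C Q R \<Longrightarrow> X \<in> Q \<Longrightarrow> Y \<in> R \<Longrightarrow> f \<in> mor C X (Shift C Y)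
    \<Longrightarrow> f = zero_mor C X (Shift C Y)"
  unfolding cotorsion_pair_def by blast

lemma cotorsion_pair_Ob:
  "cotorsion_pair C Q R \<Longrightarrow> X \<in> Q \<Longrightarrow> X \<in> Ob C"
  "cotorsion_pair C Q R \<Longrightarrow> X \<in> R \<Longrightarrow> X \<in> Ob C"
  unfolding cotorsion_pair_def additive_class_def by blast+

lemma cotorsion_pair_zero_object:
  "cotorsion_pair C Q R \<Longrightarrow> is_zero_object C Z \<Longrightarrow> Z \<in> R"
  unfolding cotorsion_pair_def additive_class_def by blast

lemma cotorsion_pair_resolution:
  assumes "cotorsion_pair C Q R" "X \<in> Ob C"
  obtains R' Q' f g h where "R' \<in> R" "Q' \<in> Q" "Tri C R' Q' X f g h"
  using assms unfolding cotorsion_pair_def by metis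

lemma cotorsion_pair_coresolution:
  assumes "cotorsion_pair C Q R" "X \<in> Ob C"
  obtains R' Q' f g h where "R' \<in> R" "Q' \<in> Q" "Tri C X R' Q' f g h"
  using assms unfolding cotorsion_pair_def by metis

lemma cotorsion_pair_summand:
  assumes "cotorsion_pair C Q R" "is_direct_sum C A B S"
  shows "S \<in> Q \<Longrightarrow> B \<in> Q" "S \<in> R \<Longrightarrow> A \<in> R"
  using assms unfolding cotorsion_pair_def additive_class_def summand_closed_def by blast+

text \<open>
  The triangle \<open>R' \<rightarrow> Q' \<rightarrow> X\<close> given by the cotorsion pair has zero connecting morphism, so it splits and
  \<open>X\<close> is a summand of \<open>Q'\<close>. Thus \<open>Q\<close> is the full left orthogonal of \<open>R\<close>, which determines it.
\<close>
lemma left_class_characterization: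
  assumes "cotorsion_pair C Q R" "X \<in> Ob C"
    and "\<And>Y t. Y \<in> R \<Longrightarrow> t \<in> mor C X (Shift C Y) \<Longrightarrow> t = zero_mor C X (Shift C Y)"
  shows "X \<in> Q"
  using cotorsion_pair_resolution[OF assms(1,2)] Tri_split Tri_mor assms cotorsion_pair_summand(1)
  by metis

lemma right_class_characterization:
  assumes "cotorsion_pair C Q R" "X \<in> Ob C"
    and "\<And>Y s. Y \<in> Q \<Longrightarrow> s \<in> mor C Y (Shift C X) \<Longrightarrow> s = zero_mor C Y (Shift C X)"
  shows "X \<in> R"
  using cotorsion_pair_coresolution[OF assms(1,2)] Tri_split Tri_mor assms cotorsion_pair_summand(2)
  by metis

lemma cotorsion_pair_left_unique:
  assumes "cotorsion_pair C Q R" "cotorsion_pair C Q' R"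
  shows "Q = Q'"
proof
  show "Q \<subseteq> Q'"
    using left_class_characterization[OF assms(2)] cotorsion_pair_orthogonal[OF assms(1)]
      cotorsion_pair_Ob[OF assms(1)] by blast
  show "Q' \<subseteq> Q"
    using left_class_characterization[OF assms(1)] cotorsion_pair_orthogonal[OF assms(2)]
      cotorsion_pair_Ob[OF assms(2)] by blast
qed

lemma cotorsion_pair_right_unique:
  assumes "cotorsion_pair C Q R" "cotorsion_pair C Q R'"
  shows "R = R'"
proof
  show "R \<subseteq> R'"
    using right_class_characterization[OF assms(2)] cotorsion_pair_orthogonal[OF assms(1)]
      cotorsion_pair_Ob[OF assms(1)] by blast
  show "R' \<subseteq> R"
    using right_class_characterization[OF assms(1)] cotorsion_pair_orthogonal[OF assms(2)]
      cotorsion_pair_Ob[OF assms(2)] by blast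
qed

lemma left_class_extension_closed:
  assumes c: "cotorsion_pair C Q R" and T: "Tri C X Y Z f g h" and "X \<in> Q" "Z \<in> Q"
  shows "Y \<in> Q"
proof (rule left_class_characterization[OF c])
  note m = Tri_mor[OF T]
  show "Y \<in> Ob C" using m by blast
  fix V t assume V: "V \<in> R" and t: "t \<in> mor C Y (Shift C V)"
  have Vo: "Shift C V \<in> Ob C" using V cotorsion_pair_Ob[OF c] Shift_Ob by blast
  have "t \<cdot> f = zero_mor C X (Shift C V)"
    using cotorsion_pair_orthogonal[OF c \<open>X \<in> Q\<close> V] Comp_mor t m Vo by blast
  then obtain u where u: "u \<in> mor C Z (Shift C V)" "t = u \<cdot> g"
    using Tri_extend_middle[OF T Vo t] by blast
  then show "t = zero_mor C Y (Shift C V)"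
    using cotorsion_pair_orthogonal[OF c \<open>Z \<in> Q\<close> V] zero_Comp m Vo by metis
qed

lemma right_class_extension_closed:
  assumes c: "cotorsion_pair C Q R" and T: "Tri C X Y Z f g h" and "X \<in> R" "Z \<in> R"
  shows "Y \<in> R"
proof (rule right_class_characterization[OF c])
  note m = Tri_mor[OF T]
  note T'' = Tri_rotate_left[OF Tri_rotate_left[OF Tri_rotate_left[OF T]]]
  note m'' = Tri_mor[OF T'']
  let ?f = "neg_mor C (Shift C X) (Shift C Y) (ShiftM C f)"
  let ?g = "neg_mor C (Shift C Y) (Shift C Z) (ShiftM C g)"
  show "Y \<in> Ob C" using m by blast
  fix A s assume A: "A \<in> Q" and s: "s \<in> mor C A (Shift C Y)"
  have Ao: "A \<in> Ob C" using A cotorsion_pair_Ob[OF c] by blast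
  have "?g \<cdot> s = zero_mor C A (Shift C Z)"
    using cotorsion_pair_orthogonal[OF c A \<open>Z \<in> R\<close>] Comp_mor s m'' Ao by blast
  then obtain w where w: "w \<in> mor C A (Shift C X)" "s = ?f \<cdot> w"
    using Tri_exact[OF T'' Ao s] by blast
  then show "s = zero_mor C A (Shift C Y)"
    using cotorsion_pair_orthogonal[OF c A \<open>X \<in> R\<close>] Comp_zero m'' Ao by metis
qed

text \<open>
  From the triangle \<open>Y \<rightarrow> 0 \<rightarrow> Y[1]\<close>. In this form heredity yields the vanishing of morphisms from \<open>Q\<close>
  to \<open>R[2]\<close>.
\<close>
lemma hereditary_right_shift:
  assumes "hereditary_cotorsion_pair C Q R" "Y \<in> R"
  shows "Shift C Y \<in> R"
proof -
  have c: "cotorsion_pair C Q R" using assms(1) by (simp add: hereditary_cotorsion_pair_def)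
  obtain Z where Z: "is_zero_object C Z" using zero_object_exists by blast
  show ?thesis
    using Tri_to_zero[OF cotorsion_pair_Ob(2)[OF c assms(2)] Z] cotorsion_pair_zero_object[OF c Z]
      assms unfolding hereditary_cotorsion_pair_def by blast
qed

end


section \<open>The class of trivial objects\<close>

locale compatible_cotorsion_pairs = triangulated_category C
  for C :: "('o, 'm, 'x) triang_data_scheme" (structure) +
  fixes Q R Qt Rt :: "'o set"
  assumes her_Q: "hereditary_cotorsion_pair C Q Rt"
    and her_R: "hereditary_cotorsion_pair C Qt R"
    and Rt_sub: "Rt \<subseteq> R"
    and Qt_sub: "Qt \<subseteq> Q"
    and core_eq: "Qt \<inter> R = Q \<inter> Rt"
begin

definition trivial :: "'o set" where
  "trivial = {X \<in> Ob C. \<forall>A\<in>Q. \<forall>B\<in>R. \<forall>s\<in>mor C A X. \<forall>t\<in>mor C X (Shift C B).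
     t \<cdot> s = zero_mor C A (Shift C B)}"

definition fibres :: "'o set" where
  "fibres = {X \<in> Ob C. \<exists>R'\<in>Rt. \<exists>Q'\<in>Qt. \<exists>f g h. Tri C X R' Q' f g h}"

definition cofibres :: "'o set" where
  "cofibres = {X \<in> Ob C. \<exists>R'\<in>Rt. \<exists>Q'\<in>Qt. \<exists>f g h. Tri C R' Q' X f g h}"

lemma cot_Q: "cotorsion_pair C Q Rt" and cot_R: "cotorsion_pair C Qt R"
  using her_Q her_R by (simp_all add: hereditary_cotorsion_pair_def)

lemmas Q_Ob = cotorsion_pair_Ob(1)[OF cot_Q] and Rt_Ob = cotorsion_pair_Ob(2)[OF cot_Q]
  and Qt_Ob = cotorsion_pair_Ob(1)[OF cot_R] and R_Ob = cotorsion_pair_Ob(2)[OF cot_R]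

text \<open>
  The obstruction is a morphism from \<open>Q\<close> to \<open>Rt[1]\<close>.
\<close>
lemma lift_along_Rt:
  assumes T: "Tri C K Y Z f g h" and "K \<in> Rt" "A \<in> Q" "s \<in> mor C A Z"
  obtains w where "w \<in> mor C A Y" "s = g \<cdot> w"
proof -
  have "h \<cdot> s = zero_mor C A (Shift C K)"
    using cotorsion_pair_orthogonal[OF cot_Q \<open>A \<in> Q\<close> \<open>K \<in> Rt\<close>] Comp_mor Tri_mor[OF T] assms
      Q_Ob Shift_Ob by metis
  then show thesis using Tri_lift[OF T] assms Q_Ob that by blast
qed

text \<open>
  The obstruction, after a shift, is a morphism from \<open>Qt\<close> to \<open>R[2]\<close>; it vanishes by heredity.
\<close>
lemma extend_along_Qt:
  assumes T: "Tri C X Y K f g h" and "K \<in> Qt" "B \<in> R" "t \<in> mor C X (Shift C B)"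
  obtains u where "u \<in> mor C Y (Shift C B)" "t = u \<cdot> f"
proof -
  have B: "Shift C B \<in> R" using hereditary_right_shift[OF her_R \<open>B \<in> R\<close>] .
  have Bo: "Shift C B \<in> Ob C" "Shift C (Shift C B) \<in> Ob C" using R_Ob assms Shift_Ob by blast+
  have "ShiftM C t \<cdot> h = zero_mor C K (Shift C (Shift C B))"
    using cotorsion_pair_orthogonal[OF cot_R \<open>K \<in> Qt\<close> B] Comp_mor Tri_mor[OF T] assms Bo
      Shift_Ob ShiftM_mor by metis
  then show thesis using Tri_extend[OF T] assms Bo that by blast
qed

lemma through_Qt_zero:
  assumes "A \<in> Ob C" "K \<in> Qt" "B \<in> R" "s \<in> mor C A K" "t \<in> mor C K (Shift C B)"
  shows "t \<cdot> s = zero_mor C A (Shift C B)"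
  using cotorsion_pair_orthogonal[OF cot_R assms(2,3,5)] zero_Comp[of A K] assms Qt_Ob R_Ob Shift_Ob
  by metis

text \<open>
  Morphisms from \<open>K\<close> to \<open>R[1]\<close> need not vanish. But \<open>K\<close> has a resolution \<open>R' \<rightarrow> Q' \<rightarrow> K\<close> whose middle term
  lies in \<open>Rt\<close>, as an extension of \<open>K\<close> by \<open>R'\<close>, and so in \<open>Q \<inter> Rt = Qt \<inter> R\<close>. The first factor lifts to \<open>Q'\<close>, and
  morphisms from \<open>Qt\<close> to \<open>R[1]\<close> do vanish.
\<close>
lemma through_Rt_zero:
  assumes "A \<in> Q" "K \<in> Rt" "B \<in> R" "s \<in> mor C A K" "t \<in> mor C K (Shift C B)"
  shows "t \<cdot> s = zero_mor C A (Shift C B)"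
proof -
  have K: "K \<in> Ob C" and A: "A \<in> Ob C" and B: "Shift C B \<in> Ob C"
    using Rt_Ob Q_Ob R_Ob Shift_Ob assms by blast+
  obtain R' Q' f g h where q: "R' \<in> Rt" "Q' \<in> Q" and T: "Tri C R' Q' K f g h"
    using cotorsion_pair_resolution[OF cot_Q K] .
  note m = Tri_mor[OF T]
  have "Q' \<in> Rt"
    using right_class_extension_closed[OF cot_Q T] q assms by blast
  then have Q': "Q' \<in> Qt" using q core_eq by blast
  obtain w where w: "w \<in> mor C A Q'" "s = g \<cdot> w"
    using lift_along_Rt[OF T] q assms by blast
  have "t \<cdot> s = (t \<cdot> g) \<cdot> w"
    using Comp_assoc[of A Q' K "Shift C B" w g t] w assms m A B by metis
  also have "\<dots> = zero_mor C A (Shift C B)"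
    using through_Qt_zero[OF A Q' \<open>B \<in> R\<close> w(1)] Comp_mor m B assms by blast
  finally show ?thesis .
qed

lemma Qt_subset_trivial: "Qt \<subseteq> trivial"
  unfolding trivial_def using through_Qt_zero Q_Ob Qt_Ob by blast

lemma Rt_subset_trivial: "Rt \<subseteq> trivial"
  unfolding trivial_def using through_Rt_zero Rt_Ob by blast

lemma cofibres_subset_trivial: "cofibres \<subseteq> trivial"
proof
  fix X assume "X \<in> cofibres"
  then obtain R' Q' f g h where r: "R' \<in> Rt" "Q' \<in> Qt" and T: "Tri C R' Q' X f g h"
    unfolding cofibres_def by blast
  note m = Tri_mor[OF T]
  have "t \<cdot> s = zero_mor C A (Shift C B)"
    if ab: "A \<in> Q" "B \<in> R" "s \<in> mor C A X" "t \<in> mor C X (Shift C B)" for A B s t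
  proof -
    have o: "A \<in> Ob C" "Shift C B \<in> Ob C" using ab Q_Ob R_Ob Shift_Ob by blast+
    obtain w where w: "w \<in> mor C A Q'" "s = g \<cdot> w"
      using lift_along_Rt[OF T r(1) ab(1,3)] .
    have "t \<cdot> s = (t \<cdot> g) \<cdot> w"
      using Comp_assoc[of A Q' X "Shift C B" w g t] w ab m o by metis
    also have "\<dots> = zero_mor C A (Shift C B)"
      using through_Qt_zero[OF o(1) r(2) ab(2) w(1)] Comp_mor m o ab by blast
    finally show ?thesis .
  qed
  then show "X \<in> trivial" unfolding trivial_def using m by blast
qed

lemma fibres_subset_trivial: "fibres \<subseteq> trivial"
proof
  fix X assume "X \<in> fibres"
  then obtain R' Q' f g h where r: "R' \<in> Rt" "Q' \<in> Qt" and T: "Tri C X R' Q' f g h"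
    unfolding fibres_def by blast
  note m = Tri_mor[OF T]
  have "t \<cdot> s = zero_mor C A (Shift C B)"
    if ab: "A \<in> Q" "B \<in> R" "s \<in> mor C A X" "t \<in> mor C X (Shift C B)" for A B s t
  proof -
    have o: "A \<in> Ob C" "Shift C B \<in> Ob C" using ab Q_Ob R_Ob Shift_Ob by blast+
    obtain u where u: "u \<in> mor C R' (Shift C B)" "t = u \<cdot> f"
      using extend_along_Qt[OF T r(2) ab(2,4)] .
    have "t \<cdot> s = u \<cdot> (f \<cdot> s)"
      using Comp_assoc[of A X R' "Shift C B" s f u] u ab m o by metis
    also have "\<dots> = zero_mor C A (Shift C B)"
      using through_Rt_zero[OF ab(1) r(1) ab(2) _ u(1)] Comp_mor m o ab by blast
    finally show ?thesis .
  qed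
  then show "X \<in> trivial" unfolding trivial_def using m by blast
qed

text \<open>
  Resolve \<open>X\<close> by both pairs, \<open>R0 \<rightarrow> Q0 \<rightarrow> X\<close> with \<open>Q0\<close> in \<open>Q\<close> and \<open>R1 \<rightarrow> Q1 \<rightarrow> X\<close> with \<open>Q1\<close> in \<open>Qt\<close>. Triviality
  kills \<open>Q0 \<rightarrow> X \<rightarrow> R1[1]\<close>, so \<open>Q0 \<rightarrow> X\<close> lifts to \<open>u: Q0 \<rightarrow> Q1\<close>; orthogonality gives \<open>v: Q1 \<rightarrow> Q0\<close> over \<open>X\<close>. Then
  \<open>v \<cdot> u\<close> and the identity of \<open>Q0\<close> agree over \<open>X\<close>, so they differ by a morphism through \<open>R0\<close>. Every
  morphism from \<open>Q0\<close> to \<open>R[1]\<close> vanishes on both parts, whence \<open>Q0\<close> lies in \<open>Qt\<close>.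
\<close>
lemma trivial_subset_cofibres: "trivial \<subseteq> cofibres"
proof
  fix X assume X: "X \<in> trivial"
  then have Xo: "X \<in> Ob C" by (simp add: trivial_def)
  obtain R0 Q0 f0 g0 h0 where q0: "R0 \<in> Rt" "Q0 \<in> Q" and T0: "Tri C R0 Q0 X f0 g0 h0"
    using cotorsion_pair_resolution[OF cot_Q Xo] .
  obtain R1 Q1 f1 g1 h1 where q1: "R1 \<in> R" "Q1 \<in> Qt" and T1: "Tri C R1 Q1 X f1 g1 h1"
    using cotorsion_pair_resolution[OF cot_R Xo] .
  note m0 = Tri_mor[OF T0] and m1 = Tri_mor[OF T1]
  have "h1 \<cdot> g0 = zero_mor C Q0 (Shift C R1)"
    using X q0 q1 m0 m1 unfolding trivial_def by blast
  then obtain u where u: "u \<in> mor C Q0 Q1" "g0 = g1 \<cdot> u"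
    using Tri_lift[OF T1] m0 by blast
  obtain v where v: "v \<in> mor C Q1 Q0" "g1 = g0 \<cdot> v"
    using lift_along_Rt[OF T0] q0 q1 Qt_sub m1 by blast
  have vu: "v \<cdot> u \<in> mor C Q0 Q0" using Comp_mor u v m0 m1 by blast
  have "g0 \<cdot> Id C Q0 = g0 \<cdot> (v \<cdot> u)"
    using Comp_assoc[of Q0 Q1 Q0 X u v g0] u v m0 m1 Comp_Id by metis
  then obtain w where w: "w \<in> mor C Q0 R0" "Id C Q0 = add_mor C Q0 Q0 (v \<cdot> u) (f0 \<cdot> w)"
    using Tri_difference_factors[OF T0 _ Id_mor vu] m0 by blast
  have fw: "f0 \<cdot> w \<in> mor C Q0 Q0" using Comp_mor w m0 by blast
  have "Q0 \<in> Qt"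
  proof (rule left_class_characterization[OF cot_R])
    show "Q0 \<in> Ob C" using m0 by blast
    fix B t assume B: "B \<in> R" and t: "t \<in> mor C Q0 (Shift C B)"
    have o: "Q0 \<in> Ob C" "R0 \<in> Ob C" "Q1 \<in> Ob C" "Shift C B \<in> Ob C"
      using m0 m1 B R_Ob Shift_Ob by blast+
    have "t \<cdot> (v \<cdot> u) = (t \<cdot> v) \<cdot> u"
      using Comp_assoc[of Q0 Q1 Q0 "Shift C B" u v t] u v t o by metis
    then have 1: "t \<cdot> (v \<cdot> u) = zero_mor C Q0 (Shift C B)"
      using through_Qt_zero[OF o(1) q1(2) B u(1)] Comp_mor t v o by metis
    have "t \<cdot> (f0 \<cdot> w) = (t \<cdot> f0) \<cdot> w"
      using Comp_assoc[of Q0 R0 Q0 "Shift C B" w f0 t] w t m0 o by metis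
    then have 2: "t \<cdot> (f0 \<cdot> w) = zero_mor C Q0 (Shift C B)"
      using through_Rt_zero[OF q0(2) q0(1) B w(1)] Comp_mor t m0 o by metis
    have "t = t \<cdot> add_mor C Q0 Q0 (v \<cdot> u) (f0 \<cdot> w)"
      using w(2) Comp_Id t o by metis
    also have "\<dots> = zero_mor C Q0 (Shift C B)"
      using Comp_add_right[OF o(1,1,4) vu fw t] 1 2 add_zero zero_in_mor o by metis
    finally show "t = zero_mor C Q0 (Shift C B)" .
  qed
  then show "X \<in> cofibres" unfolding cofibres_def using q0 T0 Xo by blast
qed

text \<open>
  Push \<open>R' \<rightarrow> Q' \<rightarrow> X\<close> out along \<open>Q' \<rightarrow> R1\<close>, where \<open>Q' \<rightarrow> R1 \<rightarrow> Q1\<close> comes from the pair \<open>(Qt, R)\<close>. The middle term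
  \<open>R1\<close> is an extension of objects of \<open>Qt\<close>, so it lies in \<open>Qt \<inter> R \<subseteq> Rt\<close>, and heredity puts the cone \<open>Z\<close> of
  \<open>R' \<rightarrow> R1\<close> into \<open>Rt\<close>. The octahedron gives \<open>X \<rightarrow> Z \<rightarrow> Q1\<close>.
\<close>
lemma cofibres_subset_fibres: "cofibres \<subseteq> fibres"
proof
  fix X assume "X \<in> cofibres"
  then obtain R' Q' f g h where r: "R' \<in> Rt" "Q' \<in> Qt" and T: "Tri C R' Q' X f g h"
    unfolding cofibres_def by blast
  note m = Tri_mor[OF T]
  obtain R1 Q1 f1 g1 h1 where q1: "R1 \<in> R" "Q1 \<in> Qt" and T1: "Tri C Q' R1 Q1 f1 g1 h1"
    using cotorsion_pair_coresolution[OF cot_R, of Q'] m by blast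
  note m1 = Tri_mor[OF T1]
  have "R1 \<in> Qt" using left_class_extension_closed[OF cot_R T1] r q1 by blast
  then have R1: "R1 \<in> Rt" using q1 core_eq by blast
  obtain Z e k where Z: "Tri C R' R1 Z (f1 \<cdot> f) e k"
    using Tri_cone[of R' R1 "f1 \<cdot> f"] Comp_mor[of R' Q' R1] m m1 by blast
  obtain u v where "Tri C X Z Q1 u v (ShiftM C g \<cdot> h1)"
    using Tri_octahedral[OF T T1 Z] by blast
  moreover have "Z \<in> Rt" using her_Q Z r R1 unfolding hereditary_cotorsion_pair_def by blast
  ultimately show "X \<in> fibres" unfolding fibres_def using q1 m by blast
qed

lemma trivial_eq_fibres: "trivial = fibres"
  and trivial_eq_cofibres: "trivial = cofibres"
  using cofibres_subset_trivial fibres_subset_trivial trivial_subset_cofibres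
    cofibres_subset_fibres by blast+

text \<open>
  Rotation identifies the triangles \<open>X \<rightarrow> R' \<rightarrow> Q'\<close> with the triangles \<open>R' \<rightarrow> Q' \<rightarrow> X[1]\<close>; the
  former make \<open>X\<close> a fibre, the latter make \<open>X[1]\<close> a cofibre, and both classes are the trivial objects.
\<close>
lemma Shift_trivial_iff:
  assumes "X \<in> Ob C"
  shows "Shift C X \<in> trivial \<longleftrightarrow> X \<in> trivial"
proof
  assume "Shift C X \<in> trivial"
  then obtain R' Q' f g h where r: "R' \<in> Rt" "Q' \<in> Qt" and T: "Tri C R' Q' (Shift C X) f g h"
    unfolding trivial_eq_cofibres cofibres_def by blast
  obtain e where "Tri C X R' Q' e f g" using Tri_rotate_right[OF T assms] .
  then show "X \<in> trivial"
    unfolding trivial_eq_fibres fibres_def using r assms by blast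
next
  assume "X \<in> trivial"
  then obtain R' Q' f g h where "R' \<in> Rt" "Q' \<in> Qt" "Tri C X R' Q' f g h"
    unfolding trivial_eq_fibres fibres_def by blast
  then show "Shift C X \<in> trivial"
    unfolding trivial_eq_cofibres cofibres_def
    using Tri_rotate_left[of X R' Q' f g h] Shift_Ob[OF assms] by blast
qed

lemma trivial_summand_closed: "summand_closed C trivial"
proof -
  have *: "A \<in> trivial"
    if "S \<in> trivial" "A \<in> Ob C" "i \<in> mor C A S" "p \<in> mor C S A" "p \<cdot> i = Id C A" for A S i p
  proof -
    have S: "S \<in> Ob C" using that(1) by (simp add: trivial_def)
    have "t \<cdot> s = zero_mor C D (Shift C B)"
      if D: "D \<in> Q" "B \<in> R" and st: "s \<in> mor C D A" "t \<in> mor C A (Shift C B)" for D B s t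
    proof -
      have o: "D \<in> Ob C" "Shift C B \<in> Ob C" using D Q_Ob R_Ob Shift_Ob by blast+
      have is': "i \<cdot> s \<in> mor C D S" and tp: "t \<cdot> p \<in> mor C S (Shift C B)"
        using Comp_mor o st S \<open>A \<in> Ob C\<close> \<open>i \<in> mor C A S\<close> \<open>p \<in> mor C S A\<close> by blast+
      have "(t \<cdot> p) \<cdot> (i \<cdot> s) = t \<cdot> (p \<cdot> (i \<cdot> s))"
        using Comp_assoc[of D S A "Shift C B" "i \<cdot> s" p t] is' st o S \<open>A \<in> Ob C\<close> \<open>p \<in> mor C S A\<close>
        by blast
      also have "p \<cdot> (i \<cdot> s) = s"
        using Comp_assoc[of D A S A s i p] Id_Comp[of D A s] st o S \<open>A \<in> Ob C\<close> \<open>p \<in> mor C S A\<close>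
          \<open>i \<in> mor C A S\<close> \<open>p \<cdot> i = Id C A\<close> by metis
      finally show ?thesis
        using \<open>S \<in> trivial\<close> is' tp D unfolding trivial_def by auto
    qed
    then show ?thesis unfolding trivial_def using \<open>A \<in> Ob C\<close> by blast
  qed
  show ?thesis
    unfolding summand_closed_def is_direct_sum_def using * by blast
qed

text \<open>
  Choose \<open>Y \<rightarrow> RY \<rightarrow> QY\<close> and let \<open>Z'\<close> be the cone of \<open>X \<rightarrow> Y \<rightarrow> RY\<close>. The octahedron gives \<open>Z \<rightarrow> Z' \<rightarrow> QY\<close>, so
  a morphism \<open>Z \<rightarrow> B[1]\<close> extends to \<open>Z'\<close> and it is enough to treat composites through \<open>Z'\<close>. With
  \<open>R' \<rightarrow> Q' \<rightarrow> X[1]\<close>, the triangle \<open>RY \<rightarrow> Z' \<rightarrow> X[1]\<close> shows that every morphism from \<open>Q\<close> to \<open>Z'\<close> is the sum of one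
  through \<open>Q'\<close> and one through \<open>RY\<close>, and both parts die in \<open>B[1]\<close>.
\<close>
lemma trivial_cone_closed:
  assumes T: "Tri C X Y Z f g h" and "X \<in> trivial" "Y \<in> trivial"
  shows "Z \<in> trivial"
proof -
  note m = Tri_mor[OF T]
  obtain RY QY a b c where y: "RY \<in> Rt" "QY \<in> Qt" and TY: "Tri C Y RY QY a b c"
    using \<open>Y \<in> trivial\<close> unfolding trivial_eq_fibres fibres_def by blast
  note mY = Tri_mor[OF TY]
  have "Shift C X \<in> trivial" using \<open>X \<in> trivial\<close> Shift_trivial_iff m by blast
  then obtain R' Q' f' g' h' where x: "R' \<in> Rt" "Q' \<in> Qt" and TX: "Tri C R' Q' (Shift C X) f' g' h'"
    unfolding trivial_eq_cofibres cofibres_def by blast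
  note mX = Tri_mor[OF TX]
  obtain Z' e k where TZ: "Tri C X RY Z' (a \<cdot> f) e k"
    using Tri_cone[of X RY "a \<cdot> f"] Comp_mor[of X Y RY] m mY by blast
  note mZ = Tri_mor[OF TZ]
  obtain u v where u: "u \<in> mor C Z Z'" and TO: "Tri C Z Z' QY u v (ShiftM C g \<cdot> c)"
    using Tri_octahedral[OF T TY TZ] by blast
  have "t \<cdot> s = zero_mor C A (Shift C B)"
    if A: "A \<in> Q" and B: "B \<in> R" and s: "s \<in> mor C A Z" and t: "t \<in> mor C Z (Shift C B)" for A B s t
  proof -
    have o: "A \<in> Ob C" "Shift C B \<in> Ob C" "Z' \<in> Ob C" "RY \<in> Ob C" "Q' \<in> Ob C" "Shift C X \<in> Ob C"
      using A B mZ mX mY Q_Ob R_Ob Shift_Ob by blast+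
    obtain t' where t': "t' \<in> mor C Z' (Shift C B)" "t = t' \<cdot> u"
      using extend_along_Qt[OF TO y(2) B t] .
    have us: "u \<cdot> s \<in> mor C A Z'" using Comp_mor u s o m by blast
    have kus: "k \<cdot> (u \<cdot> s) \<in> mor C A (Shift C X)" using Comp_mor us o mZ by blast
    obtain d where d: "d \<in> mor C A Q'" "k \<cdot> (u \<cdot> s) = g' \<cdot> d"
      using lift_along_Rt[OF TX x(1) A kus] .
    \<comment> \<open>The obstruction to lifting \<open>Q' \<rightarrow> X[1]\<close> along \<open>Z' \<rightarrow> X[1]\<close> lies in the morphisms from \<open>Q'\<close> to \<open>RY[1]\<close>.\<close>
    obtain l where l: "l \<in> mor C Q' Z'" "g' = k \<cdot> l"
    proof -
      have "Q' \<in> Q" using x Qt_sub by blast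
      let ?n = "neg_mor C (Shift C X) (Shift C RY) (ShiftM C (a \<cdot> f))"
      note TZ' = Tri_rotate_left[OF TZ]
      have n: "?n \<in> mor C (Shift C X) (Shift C RY)" using Tri_mor[OF TZ'] by blast
      have "?n \<cdot> g' = zero_mor C Q' (Shift C RY)"
        using cotorsion_pair_orthogonal[OF cot_Q \<open>Q' \<in> Q\<close> y(1)] Comp_mor[of Q' "Shift C X" "Shift C RY"]
          n mX o Shift_Ob by blast
      then show thesis using Tri_lift[OF TZ' o(5), of g'] mX that by blast
    qed
    have ld: "l \<cdot> d \<in> mor C A Z'" using Comp_mor l d o by blast
    have "k \<cdot> (u \<cdot> s) = k \<cdot> (l \<cdot> d)"
      using Comp_assoc[of A Q' Z' "Shift C X" d l k] d l o mZ by metis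
    then obtain w where w: "w \<in> mor C A RY" "u \<cdot> s = add_mor C A Z' (l \<cdot> d) (e \<cdot> w)"
      using Tri_difference_factors[OF Tri_rotate_left[OF TZ] o(1) us ld] by blast
    have ew: "e \<cdot> w \<in> mor C A Z'" using Comp_mor w o mZ by blast
    have "t' \<cdot> (l \<cdot> d) = (t' \<cdot> l) \<cdot> d"
      using Comp_assoc[of A Q' Z' "Shift C B" d l t'] d l t' o by metis
    then have 1: "t' \<cdot> (l \<cdot> d) = zero_mor C A (Shift C B)"
      using through_Qt_zero[OF o(1) x(2) B d(1)] Comp_mor t' l o by metis
    have "t' \<cdot> (e \<cdot> w) = (t' \<cdot> e) \<cdot> w"
      using Comp_assoc[of A RY Z' "Shift C B" w e t'] w mZ t' o by metis
    then have 2: "t' \<cdot> (e \<cdot> w) = zero_mor C A (Shift C B)"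
      using through_Rt_zero[OF A y(1) B w(1)] Comp_mor t' mZ o by metis
    have "t \<cdot> s = t' \<cdot> (u \<cdot> s)"
      using Comp_assoc[of A Z Z' "Shift C B" s u t'] t' s u o m by metis
    also have "\<dots> = zero_mor C A (Shift C B)"
      using w(2) Comp_add_right[OF o(1,3,2) ld ew t'(1)] 1 2 add_zero zero_in_mor o by metis
    finally show ?thesis .
  qed
  then show ?thesis unfolding trivial_def using m by blast
qed

lemma trivial_thick: "thick C trivial"
  unfolding thick_def
proof (intro conjI allI impI; (elim conjE)?)
  show "trivial \<subseteq> Ob C" by (auto simp: trivial_def)
  show "summand_closed C trivial" by (rule trivial_summand_closed)
next
  fix X Y Z f g h assume T: "Tri C X Y Z f g h"
  note m = Tri_mor[OF T]
  note T' = Tri_rotate_left[OF T]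
  note T'' = Tri_rotate_left[OF T']
  show "Z \<in> trivial" if "X \<in> trivial" "Y \<in> trivial"
    using trivial_cone_closed[OF T] that by blast
  show "Y \<in> trivial" if "X \<in> trivial" "Z \<in> trivial"
    using trivial_cone_closed[OF T''] Shift_trivial_iff m that by blast
  show "X \<in> trivial" if "Y \<in> trivial" "Z \<in> trivial"
    using trivial_cone_closed[OF T'] Shift_trivial_iff m that by blast
qed

text \<open>
  An object \<open>X\<close> of \<open>trivial \<inter> R\<close> has a triangle \<open>X \<rightarrow> R' \<rightarrow> Q'\<close> whose connecting morphism \<open>Q' \<rightarrow> X[1]\<close> vanishes by
  orthogonality of \<open>(Qt, R)\<close>, so \<open>X\<close> is a summand of \<open>R'\<close>.
\<close>
lemma trivial_Int_R: "trivial \<inter> R = Rt"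
proof
  show "Rt \<subseteq> trivial \<inter> R" using Rt_subset_trivial Rt_sub by blast
  show "trivial \<inter> R \<subseteq> Rt"
  proof
    fix X assume "X \<in> trivial \<inter> R"
    then obtain R' Q' f g h where r: "R' \<in> Rt" "Q' \<in> Qt" "X \<in> R" and T: "Tri C X R' Q' f g h"
      unfolding trivial_eq_fibres fibres_def by blast
    then have "is_direct_sum C X Q' R'"
      using Tri_split[OF T] cotorsion_pair_orthogonal[OF cot_R] Tri_mor[OF T] by blast
    then show "X \<in> Rt" using cotorsion_pair_summand(2)[OF cot_Q] r by blast
  qed
qed

lemma Q_Int_trivial: "Q \<inter> trivial = Qt"
proof
  show "Qt \<subseteq> Q \<inter> trivial" using Qt_subset_trivial Qt_sub by blast
  show "Q \<inter> trivial \<subseteq> Qt"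
  proof
    fix X assume "X \<in> Q \<inter> trivial"
    then obtain R' Q' f g h where r: "R' \<in> Rt" "Q' \<in> Qt" "X \<in> Q" and T: "Tri C R' Q' X f g h"
      unfolding trivial_eq_cofibres cofibres_def by blast
    then have "is_direct_sum C R' X Q'"
      using Tri_split[OF T] cotorsion_pair_orthogonal[OF cot_Q] Tri_mor[OF T] by blast
    then show "X \<in> Qt" using cotorsion_pair_summand(1)[OF cot_R] r by blast
  qed
qed

lemma trivial_hovey_triple: "hovey_triple C Q trivial R"
  unfolding hovey_triple_def trivial_Int_R Q_Int_trivial using cot_Q cot_R trivial_thick by blast

lemma hovey_triple_unique:
  assumes "hovey_triple C Q W R"
  shows "W = trivial"
proof -
  have W: "thick C W" "cotorsion_pair C Q (W \<inter> R)" "cotorsion_pair C (Q \<inter> W) R"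
    using assms by (auto simp: hovey_triple_def)
  have two_of_three: "X \<in> W \<Longrightarrow> Z \<in> W \<Longrightarrow> Y \<in> W" "Y \<in> W \<Longrightarrow> Z \<in> W \<Longrightarrow> X \<in> W"
    if "Tri C X Y Z f g h" for X Y Z f g h
    using W(1) that unfolding thick_def by metis+
  have WR: "W \<inter> R = Rt" using cotorsion_pair_right_unique[OF W(2) cot_Q] .
  have QW: "Q \<inter> W = Qt" using cotorsion_pair_left_unique[OF W(3) cot_R] .
  show ?thesis
  proof
    show "W \<subseteq> trivial"
    proof
      fix X assume X: "X \<in> W"
      then have Xo: "X \<in> Ob C" using W(1) by (auto simp: thick_def)
      obtain R1 Q1 f g h where q: "R1 \<in> R" "Q1 \<in> Qt" and T: "Tri C X R1 Q1 f g h"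
        using cotorsion_pair_coresolution[OF cot_R Xo] .
      have "R1 \<in> W" using two_of_three(1)[OF T X] q QW by blast
      then show "X \<in> trivial"
        unfolding trivial_eq_fibres fibres_def using q T WR Xo by blast
    qed
    show "trivial \<subseteq> W"
    proof
      fix X assume "X \<in> trivial"
      then obtain R' Q' f g h where r: "R' \<in> Rt" "Q' \<in> Qt" and T: "Tri C X R' Q' f g h"
        unfolding trivial_eq_fibres fibres_def by blast
      then show "X \<in> W" using two_of_three(2)[OF T] WR QW by blast
    qed
  qed
qed

end

theorem corollary3p12:
  fixes C :: "('o, 'm, 'x) triang_data_scheme"
    and Q R Qt Rt :: "'o set"
  assumes "triangulated_category C"
    and "hereditary_cotorsion_pair C Q Rt"
    and "hereditary_cotorsion_pair C Qt R"
    and "Rt \<subseteq> R" and "Qt \<subseteq> Q"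
    and "Qt \<inter> R = Q \<inter> Rt"
  shows "(\<exists>!W. thick C W \<and> hovey_triple C Q W R) \<and>
    (\<forall>W. thick C W \<and> hovey_triple C Q W R \<longrightarrow>
       W = {X \<in> Ob C. \<exists>R'\<in>Rt. \<exists>Q'\<in>Qt. \<exists>f g h. Tri C X R' Q' f g h} \<and>
       W = {X \<in> Ob C. \<exists>R'\<in>Rt. \<exists>Q'\<in>Qt. \<exists>f g h. Tri C R' Q' X f g h})"
proof -
  interpret triangulated_category C by (rule assms(1))
  interpret compatible_cotorsion_pairs C Q R Qt Rt
    by unfold_locales (use assms in auto)
  have "\<exists>!W. thick C W \<and> hovey_triple C Q W R"
    using trivial_thick trivial_hovey_triple hovey_triple_unique by blast
  moreover have "W = fibres \<and> W = cofibres" if "hovey_triple C Q W R" for W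
    using hovey_triple_unique[OF that] trivial_eq_fibres trivial_eq_cofibres by simp
  ultimately show ?thesis
    unfolding fibres_def cofibres_def by simp
qed

end
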